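(* Let $U$ be a nonprincipal ultrafilter on $\omega$. Then the function $\mu_U \colon \mathcal{P}(\omega) \to [0,1]$ defined by $\mu_U(A) = \lim_{n \to U} |A \cap n|/n$ for each $A \subseteq \omega$ is not universally measurable.
   Context: $\omega = \{0,1,2,\ldots\}$, and each $n \in \omega$ is identified with $\{0,1,\ldots,n-1\}$, so $|A \cap n|$ is the number of elements of $A$ less than $n$. (The value of $|A\cap n|/n$ at $n=0$ is irrelevant, since $U$ is nonprincipal.) $U$-limit: given a nonprincipal ultrafilter $U$ on $\omega$ and a sequence $\langle x_n : n \in \omega\rangle$ of members of a compact Hausdorff space $X$, $\lim_{n \to U} x_n$ is the unique $y \in X$ such that for every open set $O \subseteq X$ containing $y$, $\{n \mid x_n \in O\} \in U$. Here $X = [0,1]$ with its usual topology. $\mathcal{P}(\omega)$ carries its usual topology, obtained by identifying it with the Cantor space $\{0,1\}^{\omega}$ (product topology) via characteristic functions. A subset of $\mathcal{P}(\omega)$ is universally measurable if it is measured by every complete finite Borel measure on $\mathcal{P}(\omega)$, i.e., if it is measurable with respect to the completion of every finite Borel measure on $\mathcal{P}(\omega)$. A function $f \colon \mathcal{P}(\omega) \to [0,1]$ is universally measurable if for every open set $O \subseteq [0,1]$ the set $\{A \subseteq \omega : f(A) \in O\}$ is a universally measurable subset of $\mathcal{P}(\omega)$. *)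

theory Defs
  imports "HOL-Analysis.Analysis"
begin

(* Ultrafilters are filters in the library's sense: a set A is a member of U iff
   eventually (\<lambda>n. n \<in> A) U.  The library's filters may be improper (bot), hence
   the first conjunct. *)
definition ultrafilter :: "'a filter \<Rightarrow> bool" where
  "ultrafilter U \<longleftrightarrow>
     U \<noteq> bot \<and> (\<forall>P. eventually P U \<or> eventually (\<lambda>x. \<not> P x) U)"

definition nonprincipal :: "'a filter \<Rightarrow> bool" where
  "nonprincipal U \<longleftrightarrow> (\<forall>a. U \<noteq> principal {a})"

(* For n = 0 the quotient is 0 / 0 = 0. *)
definition density_limit :: "nat filter \<Rightarrow> nat set \<Rightarrow> real" where
  "density_limit U A = Lim U (\<lambda>n. real (card (A \<inter> {..<n})) / real n)"

definition powerset_topology :: "'a set topology" where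
  "powerset_topology =
     pullback_topology UNIV (\<lambda>A x. x \<in> A)
       (product_topology (\<lambda>_. discrete_topology (UNIV :: bool set)) UNIV)"

definition borel_of :: "'a topology \<Rightarrow> 'a measure" where
  "borel_of X = sigma (topspace X) {S. openin X S}"

definition universally_measurable_set :: "'a topology \<Rightarrow> 'a set \<Rightarrow> bool" where
  "universally_measurable_set X S \<longleftrightarrow>
     (\<forall>M. sets M = sets (borel_of X) \<and> finite_measure M \<longrightarrow> S \<in> sets (completion M))"

definition universally_measurable ::
    "'a topology \<Rightarrow> 'b topology \<Rightarrow> ('a \<Rightarrow> 'b) \<Rightarrow> bool" where
  "universally_measurable X Y f \<longleftrightarrow>
     (\<forall>S. openin Y S \<longrightarrow> universally_measurable_set X {x \<in> topspace X. f x \<in> S})"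

(* Lim is a definite description; the next two lemmas show that the limit defining
   density_limit always exists and lies in [0,1]. *)
lemma ultrafilter_tendsto_compact:
  fixes f :: "'a \<Rightarrow> 'b :: t2_space"
  assumes U: "ultrafilter U" and K: "compact K" and f: "\<And>x. f x \<in> K"
  shows "\<exists>y\<in>K. (f \<longlongrightarrow> y) U"
proof -
  have "filtermap f U \<noteq> bot" "eventually (\<lambda>y. y \<in> K) (filtermap f U)"
    using U f by (auto simp: ultrafilter_def filtermap_bot_iff eventually_filtermap)
  then obtain y where y: "y \<in> K" "inf (nhds y) (filtermap f U) \<noteq> bot"
    using K unfolding compact_filter by blast
  have "eventually (\<lambda>x. f x \<in> S) U" if S: "open S" "y \<in> S" for S
  proof (rule ccontr)
    assume "\<not> eventually (\<lambda>x. f x \<in> S) U"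
    then have "eventually (\<lambda>x. f x \<notin> S) U"
      using U by (auto simp: ultrafilter_def)
    then have "eventually (\<lambda>z. z \<notin> S) (filtermap f U)"
      by (simp add: eventually_filtermap)
    moreover have "eventually (\<lambda>z. z \<in> S) (nhds y)"
      using S by (simp add: eventually_nhds_in_open)
    ultimately have "eventually (\<lambda>_. False) (inf (nhds y) (filtermap f U))"
      unfolding eventually_inf by blast
    then show False
      using y(2) by (simp add: trivial_limit_def)
  qed
  then show ?thesis
    using y(1) by (auto simp: tendsto_def)
qed

lemma density_limit:
  assumes U: "ultrafilter U"
  shows "((\<lambda>n. real (card (A \<inter> {..<n})) / real n) \<longlongrightarrow> density_limit U A) U"
    and "density_limit U A \<in> {0..1}"
proof -
  have "card (A \<inter> {..<n}) \<le> n" for n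
    using card_mono[of "{..<n}" "A \<inter> {..<n}"] by simp
  then have "real (card (A \<inter> {..<n})) / real n \<in> {0..1}" for n
    by (cases "n = 0") (simp_all add: divide_le_eq)
  from ultrafilter_tendsto_compact[where f = "\<lambda>n. real (card (A \<inter> {..<n})) / real n",
      OF U compact_Icc this] obtain y where
    y: "y \<in> {0..1}" "((\<lambda>n. real (card (A \<inter> {..<n})) / real n) \<longlongrightarrow> y) U"
    by (elim bexE)
  moreover have "density_limit U A = y"
    using U y(2) unfolding density_limit_def ultrafilter_def by (simp add: tendsto_Lim)
  ultimately show "((\<lambda>n. real (card (A \<inter> {..<n})) / real n) \<longlongrightarrow> density_limit U A) U"
    and "density_limit U A \<in> {0..1}"
    by auto
qed

end

theory Submission
  imports Defs "HOL-Probability.Infinite_Product_Measure" "HOL-Probability.Independent_Family"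
    "HOL-Probability.Probability_Mass_Function"
begin

text \<open>
  Choose block boundaries growing so fast that, for \<open>U\<close>-almost every \<open>n\<close>, almost all of
  \<open>{..<n}\<close> lies in the block of \<open>n\<close>. If \<open>i n\<close> denotes the index of the block of \<open>n\<close>, then the
  density of \<open>i -` E\<close> along \<open>U\<close> is \<open>1\<close> or \<open>0\<close> according to whether \<open>E\<close> belongs to the image of
  \<open>U\<close> under \<open>i\<close>, a nonprincipal ultrafilter. Universal measurability of the density would thus
  make a nonprincipal ultrafilter measurable for the fair coin-tossing measure. This is
  impossible (Sierpinski): the ultrafilter is invariant under finite changes, so the 0-1 law
  applies, while flipping all coins preserves the measure and exchanges the ultrafilter with its
  complement.
\<close>

section \<open>Coin tossing\<close>

text \<open>A product measure is determined by its values on finite-dimensional cylinders, and a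
  coordinatewise map pulls a cylinder back to the cylinder over the preimages of its sides.\<close>

lemma (in product_prob_space) distr_PiM_componentwise:
  assumes [measurable]: "\<And>i. i \<in> I \<Longrightarrow> f i \<in> measurable (M i) (M i)"
    and inv: "\<And>i. i \<in> I \<Longrightarrow> distr (M i) (M i) (f i) = M i"
  shows "distr (PiM I M) (PiM I M) (\<lambda>x. \<lambda>i\<in>I. f i (x i)) = PiM I M"
proof (rule PiM_eq)
  fix J F assume J: "finite J" "J \<subseteq> I" and F: "\<And>j. j \<in> J \<Longrightarrow> F j \<in> sets (M j)"
  define G where "G j = f j -` F j \<inter> space (M j)" for j
  have G: "G j \<in> sets (M j)" if "j \<in> J" for j
    unfolding G_def using that J F by (auto intro!: measurable_sets[of "f j" "M j" "M j"] assms)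
  have [measurable]: "(\<lambda>x. \<lambda>i\<in>I. f i (x i)) \<in> measurable (PiM I M) (PiM I M)"
    by measurable
  have "emeasure (distr (PiM I M) (PiM I M) (\<lambda>x. \<lambda>i\<in>I. f i (x i))) (emb I J (Pi\<^sub>E J F)) =
      emeasure (PiM I M) ((\<lambda>x. \<lambda>i\<in>I. f i (x i)) -` emb I J (Pi\<^sub>E J F) \<inter> space (PiM I M))"
    using J F by (intro emeasure_distr) (auto intro!: sets_PiM_I)
  also have "(\<lambda>x. \<lambda>i\<in>I. f i (x i)) -` emb I J (Pi\<^sub>E J F) \<inter> space (PiM I M) = emb I J (Pi\<^sub>E J G)"
    using J measurable_space[OF assms(1)]
    by (auto simp: prod_emb_def G_def space_PiM PiE_iff restrict_def extensional_def subset_iff split: if_splits)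
  also have "emeasure (PiM I M) \<dots> = (\<Prod>j\<in>J. emeasure (M j) (G j))"
    using J G by (intro emeasure_PiM_emb)
  also have "\<dots> = (\<Prod>j\<in>J. emeasure (distr (M j) (M j) (f j)) (F j))"
    unfolding G_def using J F by (intro prod.cong refl emeasure_distr[symmetric]) (auto intro: assms)
  also have "\<dots> = (\<Prod>j\<in>J. emeasure (M j) (F j))"
    using J by (intro prod.cong refl) (simp add: inv subset_iff)
  finally show "emeasure (distr (PiM I M) (PiM I M) (\<lambda>x. \<lambda>i\<in>I. f i (x i))) (emb I J (Pi\<^sub>E J F)) =
    (\<Prod>j\<in>J. emeasure (M j) (F j))" .
qed simp

text \<open>Kolmogorov's 0-1 law for the independent sigma-algebras \<open>A i\<close> of the single
  coordinates. Invariance under finite changes makes \<open>S\<close> a tail event: the first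
  \<open>n\<close> coordinates can be overwritten without affecting membership.\<close>

lemma PiM_zero_one:
  fixes M :: "nat \<Rightarrow> 'a measure"
  assumes M: "\<And>i. prob_space (M i)"
    and S: "S \<in> sets (PiM UNIV M)"
    and tail: "\<And>x y. x \<in> S \<Longrightarrow> y \<in> space (PiM UNIV M) \<Longrightarrow> finite {i. x i \<noteq> y i} \<Longrightarrow> y \<in> S"
  shows "measure (PiM UNIV M) S = 0 \<or> measure (PiM UNIV M) S = 1"
proof -
  interpret M: prob_space "M i" for i by (rule M)
  interpret product_prob_space M UNIV ..
  let ?P = "PiM UNIV M"
  define A where "A i = {(\<lambda>x. x i) -` B \<inter> space ?P |B. B \<in> sets (M i)}" for i
  have A_sets: "A i \<subseteq> sets ?P" for i
    by (auto simp: A_def)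
  obtain c where c: "c \<in> space ?P" using P.not_empty by blast
  show ?thesis
  proof (rule P.kolmogorov_0_1_law)
    show "sigma_algebra (space ?P) (A i)" for i
    proof -
      have "A i = sets (vimage_algebra (space ?P) (\<lambda>x. x i) (M i))"
        unfolding A_def by (subst sets_vimage_algebra2) (auto simp: space_PiM)
      then show ?thesis
        using sets.sigma_algebra_axioms[of "vimage_algebra (space ?P) (\<lambda>x. x i) (M i)"] by simp
    qed
    show "P.indep_sets A UNIV"
    proof (rule P.indep_setsI)
      fix X J assume J: "J \<noteq> {}" "J \<subseteq> UNIV" "finite J" and X: "\<forall>j\<in>J. X j \<in> A j"
      then have "\<forall>j\<in>J. \<exists>B. B \<in> sets (M j) \<and> X j = (\<lambda>x. x j) -` B \<inter> space ?P"
        by (auto simp: A_def)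
      then obtain B where B: "\<And>j. j \<in> J \<Longrightarrow> B j \<in> sets (M j)"
        "\<And>j. j \<in> J \<Longrightarrow> X j = (\<lambda>x. x j) -` B j \<inter> space ?P"
        by metis
      \<comment> \<open>The range over \<open>K \<subseteq> J\<close> covers both uses:
        \<open>J\<close> itself for the intersection, and singletons for the factors.\<close>
      have *: "measure ?P {x\<in>space ?P. \<forall>i\<in>K. x i \<in> B i} = (\<Prod>i\<in>K. measure (M i) (B i))"
        if "K \<subseteq> J" for K
        using emeasure_PiM_Collect[of K B] finite_subset[OF that J(3)] B(1) that
        by (simp add: P.emeasure_eq_measure M.emeasure_eq_measure prod_ennreal prod_nonneg subset_iff)
      have "(\<Inter>j\<in>J. X j) = {x\<in>space ?P. \<forall>i\<in>J. x i \<in> B i}"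
        using J(1) B(2) by auto
      moreover have "measure ?P (X j) = measure (M j) (B j)" if "j \<in> J" for j
      proof -
        have "X j = {x\<in>space ?P. \<forall>i\<in>{j}. x i \<in> B i}"
          using B(2)[OF that] by auto
        then show ?thesis
          using *[of "{j}"] that by simp
      qed
      ultimately show "measure ?P (\<Inter>j\<in>J. X j) = (\<Prod>j\<in>J. measure ?P (X j))"
        using *[of J] by simp
    qed (use A_sets in auto)
    have "S \<in> sigma_sets (space ?P) (\<Union> (A ` {n..}))" for n
    proof -
      let ?T = "sigma (space ?P) (\<Union> (A ` {n..}))"
      have sub: "\<Union> (A ` {n..}) \<subseteq> Pow (space ?P)"
        by (auto simp: A_def)
      \<comment> \<open>Coordinates below \<open>n\<close> are replaced by those of the fixed point
        \<open>c\<close>. Hence \<open>z\<close> is measurable with respect to the coordinates from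
        \<open>n\<close> on, while \<open>S\<close> is its own preimage under
        \<open>z\<close>.\<close>
      define z where "z x = (\<lambda>i. if i < n then c i else x i)" for x
      have z: "z x \<in> space ?P" if "x \<in> space ?P" for x
        using that c by (auto simp: z_def space_PiM PiE_iff)
      have fin: "finite {i. z x i \<noteq> x i}" "finite {i. x i \<noteq> z x i}" for x
        by (rule finite_subset[of _ "{..<n}"]; auto simp: z_def split: if_splits)+
      have "z \<in> measurable ?T ?P"
      proof (rule measurable_PiM_single)
        show "z \<in> space ?T \<rightarrow> (\<Pi>\<^sub>E i\<in>UNIV. space (M i))"
          using z by (auto simp: space_measure_of_conv space_PiM)
        fix B i assume B: "B \<in> sets (M i)"
        show "{x \<in> space ?T. z x i \<in> B} \<in> sets ?T"
        proof (cases "i < n")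
          case True
          then show ?thesis by (simp add: z_def)
        next
          case False
          then have "(\<lambda>x. x i) -` B \<inter> space ?P \<in> \<Union> (A ` {n..})"
            using B by (auto simp: A_def intro!: bexI[of _ i])
          moreover have "{x \<in> space ?T. z x i \<in> B} = (\<lambda>x. x i) -` B \<inter> space ?P"
            using False by (auto simp: z_def space_measure_of_conv)
          ultimately show ?thesis
            using sub by auto
        qed
      qed
      then have "z -` S \<inter> space ?T \<in> sets ?T"
        using S by (rule measurable_sets)
      moreover have "z -` S \<inter> space ?T = S"
        using tail[OF _ _ fin(1)] tail[OF _ z fin(2)] sets.sets_into_space[OF S]
        by (auto simp: space_measure_of_conv)
      ultimately show ?thesis
        using sub by (simp add: sets_measure_of)
    qed
    then show "S \<in> P.tail_events A"
      unfolding P.tail_events_def by blast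
  qed
qed

section \<open>The fair coin-tossing measure and its flips\<close>

definition coins :: "(nat \<Rightarrow> bool) measure" where
  "coins = PiM UNIV (\<lambda>_. measure_pmf (pmf_of_set UNIV))"

interpretation coins: prob_space coins
  unfolding coins_def by (intro prob_space_PiM measure_pmf.prob_space_axioms)

lemma space_coins [simp]: "space coins = UNIV"
  by (simp add: coins_def space_PiM)

text \<open>Required by \<open>sets_PiM_equal_borel\<close>, which identifies the product
  sigma-algebra of \<open>coins\<close> with the Borel sets of the Cantor space.\<close>

instance bool :: second_countable_topology
proof
  have "open A \<longleftrightarrow> generate_topology UNIV A" for A :: "bool set"
    by (auto intro: open_discrete generate_topology.Basis)
  then show "\<exists>B :: bool set set. countable B \<and> open = generate_topology B"
    by (intro exI[of _ UNIV]) auto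
qed

lemma sets_coins: "sets coins = sets borel"
proof -
  have "sets coins = sets (PiM (UNIV :: nat set) (\<lambda>_. borel :: bool measure))"
    unfolding coins_def by (intro sets_PiM_cong) (auto intro: borel_open[OF open_discrete])
  then show ?thesis
    by (simp only: sets_PiM_equal_borel)
qed

text \<open>Coordinatewise this is addition of \<open>d i\<close> modulo 2, a bijection of the
  two-point space, which preserves the uniform distribution. Below, \<open>d\<close> is the
  indicator of a finite set or constantly \<open>True\<close>.\<close>

lemma distr_coins_flip: "distr coins coins (\<lambda>x i. x i \<noteq> d i) = coins"
proof -
  interpret product_prob_space "\<lambda>_::nat. measure_pmf (pmf_of_set (UNIV :: bool set))" UNIV ..
  have "distr (measure_pmf (pmf_of_set UNIV)) (measure_pmf (pmf_of_set UNIV)) (\<lambda>b. b \<noteq> d i)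
      = measure_pmf (pmf_of_set UNIV)" for i
  proof -
    have "bij_betw (\<lambda>b. b \<noteq> d i) UNIV UNIV"
      by (rule involuntory_imp_bij) auto
    then have "map_pmf (\<lambda>b. b \<noteq> d i) (pmf_of_set UNIV) = pmf_of_set UNIV"
      by (intro map_pmf_of_set_bij_betw) auto
    then show ?thesis
      by (metis map_pmf_rep_eq distr_cong sets_measure_pmf sets_measure_pmf_count_space)
  qed
  then show ?thesis
    unfolding coins_def using distr_PiM_componentwise[of "\<lambda>i b. b \<noteq> d i"] by (simp add: restrict_UNIV)
qed

lemma measurable_coins_flip [measurable]: "(\<lambda>x i. x i \<noteq> d i) \<in> measurable coins coins"
  unfolding coins_def by (rule measurable_PiM_single') (auto simp: space_PiM)

lemma emeasure_coins_flip:
  "S \<in> sets coins \<Longrightarrow> emeasure coins ((\<lambda>x i. x i \<noteq> d i) -` S) = emeasure coins S"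
  using emeasure_distr[OF measurable_coins_flip, of S d] unfolding distr_coins_flip by simp

text \<open>The 0-1 law needs a set of the product sigma-algebra, whereas \<open>V\<close> is only
  assumed to lie in the completion. It is therefore applied to the saturation of a measurable part
  of \<open>V\<close> under finite changes.\<close>

lemma not_coins_measurable:
  assumes tail: "\<And>x y. x \<in> V \<Longrightarrow> finite {i. x i \<noteq> y i} \<Longrightarrow> y \<in> V"
    and compl: "\<And>x. (\<lambda>i. \<not> x i) \<in> V \<longleftrightarrow> x \<notin> V"
  shows "V \<notin> sets (completion coins)"
proof
  assume "V \<in> sets (completion coins)"
  then obtain S N N' where V: "V = S \<union> N" "N \<subseteq> N'" "N' \<in> null_sets coins" and [measurable]: "S \<in> sets coins"
    by (rule sets_completionE)
  \<comment> \<open>The saturation of \<open>S\<close> under finite changes. It is measurable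
    because there are only countably many finite sets \<open>F\<close> of naturals.\<close>
  define S' where "S' = (\<Union>F\<in>{F. finite F}. (\<lambda>x i. x i \<noteq> (i \<in> F)) -` S)"
  have S'_iff: "x \<in> S' \<longleftrightarrow> (\<exists>y\<in>S. finite {i. x i \<noteq> y i})" for x
  proof
    assume "\<exists>y\<in>S. finite {i. x i \<noteq> y i}"
    then obtain y where y: "y \<in> S" "finite {i. x i \<noteq> y i}" by blast
    moreover have "(\<lambda>i. x i \<noteq> (i \<in> {i. x i \<noteq> y i})) = y" by auto
    ultimately show "x \<in> S'" unfolding S'_def by auto
  next
    assume "x \<in> S'"
    then obtain F where F: "finite F" "(\<lambda>i. x i \<noteq> (i \<in> F)) \<in> S" by (auto simp: S'_def)
    have "{i. x i \<noteq> (x i \<noteq> (i \<in> F))} = F" by auto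
    with F show "\<exists>y\<in>S. finite {i. x i \<noteq> y i}"
      by (intro bexI[OF _ F(2)]) simp
  qed
  have "(\<lambda>x i. x i \<noteq> (i \<in> F)) -` S \<in> sets coins" for F
    using measurable_sets[OF measurable_coins_flip[of "\<lambda>i. i \<in> F"], of S] by simp
  then have S'_sets [measurable]: "S' \<in> sets coins"
    unfolding S'_def by (intro sets.countable_UN' countable_Collect_finite) auto
  have S'_V: "S' \<subseteq> V"
  proof
    fix x assume "x \<in> S'"
    then obtain y where y: "y \<in> S" "finite {i. x i \<noteq> y i}" by (auto simp: S'_iff)
    have "{i. y i \<noteq> x i} = {i. x i \<noteq> y i}" by auto
    then show "x \<in> V"
      using tail[of y x] y V(1) by auto
  qed
  have "measure coins S' = 0 \<or> measure coins S' = 1"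
    unfolding coins_def
  proof (rule PiM_zero_one)
    fix x y assume "x \<in> S'" and xy: "finite {i. x i \<noteq> y i}"
    then obtain u where u: "u \<in> S" "finite {i. x i \<noteq> u i}" by (auto simp: S'_iff)
    have "{i. y i \<noteq> u i} \<subseteq> {i. x i \<noteq> y i} \<union> {i. x i \<noteq> u i}" by auto
    then have "finite {i. y i \<noteq> u i}"
      using xy u(2) by (meson finite_UnI finite_subset)
    with u(1) show "y \<in> S'" by (auto simp: S'_iff)
  qed (use S'_sets in \<open>simp_all add: coins_def measure_pmf.prob_space_axioms\<close>)
  \<comment> \<open>\<open>S'\<close> lies inside \<open>V\<close>, so it is disjoint from its flip,
    which has the same measure; two disjoint sets of measure 1 do not fit.\<close>
  moreover have "measure coins S' \<noteq> 1"
  proof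
    assume 1: "measure coins S' = 1"
    have flip: "(\<lambda>x i. x i \<noteq> True) -` S' \<in> sets coins"
      using measurable_sets[OF measurable_coins_flip[of "\<lambda>_. True"], of S'] by simp
    have "measure coins ((\<lambda>x i. x i \<noteq> True) -` S') = 1"
      using emeasure_coins_flip[OF S'_sets, of "\<lambda>_. True"] 1 by (simp add: measure_def)
    moreover have "S' \<inter> (\<lambda>x i. x i \<noteq> True) -` S' = {}"
      using S'_V compl by auto
    ultimately have "measure coins (S' \<union> (\<lambda>x i. x i \<noteq> True) -` S') = 2"
      using coins.finite_measure_Union[OF S'_sets flip] 1 by simp
    then show False
      using coins.prob_le_1[of "S' \<union> (\<lambda>x i. x i \<noteq> True) -` S'"] by linarith
  qed
  ultimately have "S' \<in> null_sets coins"
    by (simp add: null_sets_def coins.emeasure_eq_measure)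
  moreover have "S \<subseteq> S'"
  proof
    fix x assume "x \<in> S"
    then show "x \<in> S'" unfolding S'_iff by (intro bexI[of _ x]) auto
  qed
  ultimately have T: "S \<union> N' \<in> null_sets coins"
    using V(3) by (meson null_sets.Un null_sets_subset \<open>S \<in> sets coins\<close>)
  \<comment> \<open>\<open>S \<union> N'\<close> contains \<open>V\<close>, so its flip contains the
    complement of \<open>V\<close>, and two null sets would cover the space.\<close>
  have "(\<lambda>x i. x i \<noteq> True) -` (S \<union> N') \<in> null_sets coins"
    using measurable_sets[OF measurable_coins_flip[of "\<lambda>_. True"], of "S \<union> N'"] T
      emeasure_coins_flip[of "S \<union> N'" "\<lambda>_. True"]
    by (auto simp: null_sets_def)
  then have "(S \<union> N') \<union> (\<lambda>x i. x i \<noteq> True) -` (S \<union> N') \<in> null_sets coins"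
    using T by (rule null_sets.Un[rotated])
  moreover have "(S \<union> N') \<union> (\<lambda>x i. x i \<noteq> True) -` (S \<union> N') = space coins"
  proof -
    have "x \<in> (S \<union> N') \<union> (\<lambda>x i. x i \<noteq> True) -` (S \<union> N')" for x
      using compl[of x] V by (cases "x \<in> V") auto
    then show ?thesis by auto
  qed
  ultimately show False
    using coins.emeasure_space_1 by (simp add: null_sets_def)
qed

section \<open>Density along an ultrafilter\<close>

text \<open>A proper filter that contains a singleton is the principal filter at its point, so every
  single point can be avoided, and then finitely many at once.\<close>

lemma nonprincipal_ultrafilter_finite:
  assumes U: "ultrafilter U" "nonprincipal U" and "finite A"
  shows "eventually (\<lambda>n. n \<notin> A) U"
proof -
  have "eventually (\<lambda>n. n \<noteq> a) U" for a
  proof (rule ccontr)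
    assume "\<not> eventually (\<lambda>n. n \<noteq> a) U"
    then have ev: "eventually (\<lambda>n. n = a) U"
      using U(1) by (auto simp: ultrafilter_def)
    have "eventually P U \<longleftrightarrow> P a" for P
    proof
      assume "eventually P U"
      from this ev have "eventually (\<lambda>_. P a) U" by eventually_elim simp
      then show "P a" using U(1) by (auto simp: ultrafilter_def)
    next
      assume Pa: "P a"
      from ev show "eventually P U" by eventually_elim (simp add: Pa)
    qed
    then have "U = principal {a}"
      by (simp add: filter_eq_iff eventually_principal)
    then show False using U(2) by (simp add: nonprincipal_def)
  qed
  then have "eventually (\<lambda>n. \<forall>a\<in>A. n \<noteq> a) U"
    using \<open>finite A\<close> by (simp add: eventually_ball_finite)
  then show ?thesis by eventually_elim auto
qed

text \<open>
  Cut the naturals at the factorials, so that each block is negligible relative to the start of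
  the next but one, and merge neighbouring blocks in pairs. There are two ways to pair them up;
  for one of the two, \<open>U\<close> concentrates on the second halves of the pairs.
\<close>

lemma ex_dominant_blocks:
  fixes U :: "nat filter"
  assumes U: "ultrafilter U" "nonprincipal U"
  obtains i :: "nat \<Rightarrow> nat" where
    "\<And>K. finite K \<Longrightarrow> finite (i -` K)"
    "((\<lambda>n. real (card {m\<in>{..<n}. i m \<noteq> i n}) / real n) \<longlongrightarrow> 0) U"
proof -
  \<comment> \<open>The index \<open>j\<close> of the factorial interval containing
    \<open>n\<close>; the point \<open>0\<close> lies below all of them and is exempt.\<close>
  have "\<exists>j. 1 \<le> n \<longrightarrow> 1 \<le> j \<and> fact j \<le> n \<and> n < fact (Suc j)" for n :: nat
  proof (induction n)
    case (Suc n)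
    show ?case
    proof (cases "n = 0")
      case True
      then show ?thesis by (intro exI[of _ 1]) (simp add: numeral_2_eq_2)
    next
      case False
      with Suc obtain j where j: "1 \<le> j" "fact j \<le> n" "n < fact (Suc j)" by auto
      show ?thesis
      proof (cases "Suc n = fact (Suc j)")
        case True
        have "fact (Suc j) < (fact (Suc (Suc j)) :: nat)"
          by (rule fact_less_mono_nat) auto
        with True show ?thesis by (intro exI[of _ "Suc j"]) (simp del: fact_Suc)
      next
        case False
        with j show ?thesis by (intro exI[of _ j]) auto
      qed
    qed
  qed simp
  then have "\<exists>g. \<forall>n :: nat. 1 \<le> n \<longrightarrow> 1 \<le> g n \<and> fact (g n) \<le> n \<and> n < fact (Suc (g n))"
    by (intro choice allI)
  then obtain g :: "nat \<Rightarrow> nat"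
    where "\<forall>n. 1 \<le> n \<longrightarrow> 1 \<le> g n \<and> fact (g n) \<le> n \<and> n < fact (Suc (g n))"
    by blast
  then have g: "1 \<le> g n" "fact (g n) \<le> n" "n < fact (Suc (g n))" if "1 \<le> n" for n
    using that by auto
  have g_fin: "finite {n. g n \<le> k}" for k
  proof (rule finite_subset)
    show "{n. g n \<le> k} \<subseteq> {..fact (Suc k)}"
    proof
      fix n assume n: "n \<in> {n. g n \<le> k}"
      show "n \<in> {..fact (Suc k)}"
      proof (cases "n = 0")
        case False
        then have "n < fact (Suc (g n))" using g by simp
        also have "\<dots> \<le> fact (Suc k)" using n by (intro fact_mono_nat) simp
        finally show ?thesis by simp
      qed simp
    qed
  qed simp
  \<comment> \<open>The shift \<open>q\<close> selects the pairing: with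
    \<open>i n = (g n + q) div 2\<close>, odd \<open>g n + q\<close> means that \<open>n\<close> is
    in the second half of its pair.\<close>
  obtain q where q: "eventually (\<lambda>n. odd (g n + q)) U"
  proof -
    have "eventually (\<lambda>n. odd (g n + 0)) U \<or> eventually (\<lambda>n. odd (g n + 1)) U"
      using U(1) by (auto simp: ultrafilter_def)
    then show ?thesis using that by blast
  qed
  define i where "i n = (g n + q) div 2" for n
  have i_fin: "finite (i -` K)" if K: "finite K" for K
  proof (rule finite_subset[OF _ g_fin])
    show "i -` K \<subseteq> {n. g n \<le> 2 * Max K + 1}"
    proof safe
      fix n assume "i n \<in> K"
      then have "i n \<le> Max K" using K by simp
      then show "g n \<le> 2 * Max K + 1" by (simp add: i_def)
    qed
  qed
  \<comment> \<open>Intervals \<open>g n - 1\<close> and \<open>g n\<close> form one block here, so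
    any \<open>m < n\<close> from another block is below \<open>fact (g n - 1)\<close>. As
    \<open>n\<close> is at least \<open>fact (g n) = g n * fact (g n - 1)\<close>, the proportion of
    such \<open>m\<close> is at most \<open>1 / g n\<close>.\<close>
  have bound: "real (card {m\<in>{..<n}. i m \<noteq> i n}) / real n \<le> inverse (real (g n))"
    if n: "1 \<le> n" and odd: "odd (g n + q)" for n
  proof -
    have "{m\<in>{..<n}. i m \<noteq> i n} \<subseteq> {..<fact (g n - 1)}"
    proof (rule subsetI, rule ccontr)
      fix m assume m: "m \<in> {m\<in>{..<n}. i m \<noteq> i n}" and "m \<notin> {..<fact (g n - 1)}"
      then have ge: "fact (g n - 1) \<le> m" by simp
      moreover have "(fact (g n - 1) :: nat) \<ge> 1" by (rule fact_ge_1)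
      ultimately have m1: "1 \<le> m" by linarith
      have "g m < Suc (g n)"
      proof (rule ccontr)
        assume "\<not> g m < Suc (g n)"
        then have "fact (Suc (g n)) \<le> (fact (g m) :: nat)" by (intro fact_mono_nat) simp
        then show False using g(2)[OF m1] g(3)[OF n] m by simp
      qed
      moreover have "g n - 1 < Suc (g m)"
      proof (rule ccontr)
        assume "\<not> g n - 1 < Suc (g m)"
        then have "fact (Suc (g m)) \<le> (fact (g n - 1) :: nat)" by (intro fact_mono_nat) simp
        then show False using g(3)[OF m1] ge by simp
      qed
      ultimately have "g m = g n \<or> Suc (g m) = g n" by linarith
      then have "i m = i n"
      proof
        assume "Suc (g m) = g n"
        then have "g n + q = Suc (g m + q)" by simp
        with odd show ?thesis
          unfolding i_def by (metis even_Suc even_Suc_div_two)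
      qed (simp add: i_def)
      with m show False by simp
    qed
    from card_mono[OF finite_lessThan this] have "card {m\<in>{..<n}. i m \<noteq> i n} \<le> fact (g n - 1)"
      by simp
    then have "card {m\<in>{..<n}. i m \<noteq> i n} * g n \<le> fact (g n - 1) * g n"
      by simp
    also have "\<dots> = fact (g n)"
      using g(1)[OF n] fact_reduce[of "g n", where 'a = nat] by (simp add: mult.commute)
    also have "\<dots> \<le> n" using g(2)[OF n] .
    finally have "real (card {m\<in>{..<n}. i m \<noteq> i n}) * real (g n) \<le> real n"
      unfolding of_nat_mult[symmetric] of_nat_le_iff .
    then show ?thesis
      using g(1)[OF n] n by (simp add: field_simps)
  qed
  have "filterlim g at_top U"
    unfolding filterlim_at_top
  proof
    fix k :: nat
    show "eventually (\<lambda>n. k \<le> g n) U"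
      using nonprincipal_ultrafilter_finite[OF U g_fin[of k]] by eventually_elim simp
  qed
  then have lim: "((\<lambda>n. inverse (real (g n))) \<longlongrightarrow> 0) U"
    by (intro tendsto_inverse_0_at_top filterlim_compose[OF filterlim_real_sequentially])
  have "((\<lambda>n. real (card {m\<in>{..<n}. i m \<noteq> i n}) / real n) \<longlongrightarrow> 0) U"
  proof (rule tendsto_sandwich[OF _ _ tendsto_const lim])
    show "eventually (\<lambda>n. real (card {m\<in>{..<n}. i m \<noteq> i n}) / real n \<le> inverse (real (g n))) U"
      using q nonprincipal_ultrafilter_finite[OF U finite.insertI[OF finite.emptyI, of 0]]
      by eventually_elim (rule bound, simp_all)
  qed simp
  with i_fin show ?thesis by (rule that)
qed

text \<open>If \<open>i n \<in> E\<close>, any \<open>m < n\<close> with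
  \<open>i m \<notin> E\<close> lies in a block other than that of \<open>n\<close>; if
  \<open>i n \<notin> E\<close>, the same holds for any \<open>m < n\<close> with
  \<open>i m \<in> E\<close>. The proportion of such \<open>m\<close> vanishes along
  \<open>U\<close>.\<close>

lemma density_limit_blocks:
  assumes U: "ultrafilter U" "nonprincipal U"
    and lim: "((\<lambda>n. real (card {m\<in>{..<n}. i m \<noteq> i n}) / real n) \<longlongrightarrow> 0) U"
  shows "density_limit U (i -` E) = of_bool (eventually (\<lambda>n. i n \<in> E) U)"
proof -
  let ?r = "\<lambda>n. real (card {m\<in>{..<n}. i m \<noteq> i n}) / real n"
  let ?d = "\<lambda>n. real (card (i -` E \<inter> {..<n})) / real n"
  have bot: "U \<noteq> bot" using U(1) by (simp add: ultrafilter_def)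
  note d = density_limit(1)[OF U(1), of "i -` E"]
  \<comment> \<open>At \<open>n = 0\<close> both quotients are \<open>0\<close>, and the lower bound
    \<open>1 - ?r n \<le> ?d n\<close> fails.\<close>
  have pos: "eventually (\<lambda>n. n \<notin> {0}) U"
    by (rule nonprincipal_ultrafilter_finite[OF U]) simp
  show ?thesis
  proof (cases "eventually (\<lambda>n. i n \<in> E) U")
    case True
    have "(?d \<longlongrightarrow> 1) U"
    proof (rule tendsto_sandwich)
      show "((\<lambda>n. 1 - ?r n) \<longlongrightarrow> 1) U"
        using tendsto_diff[OF tendsto_const lim, of 1] by simp
      show "eventually (\<lambda>n. 1 - ?r n \<le> ?d n) U"
        using True pos
      proof eventually_elim
        case (elim n)
        have "{..<n} \<subseteq> {m\<in>{..<n}. i m \<noteq> i n} \<union> (i -` E \<inter> {..<n})"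
          using elim by auto
        then have "card {..<n} \<le> card ({m\<in>{..<n}. i m \<noteq> i n} \<union> (i -` E \<inter> {..<n}))"
          by (intro card_mono) auto
        also have "\<dots> \<le> card {m\<in>{..<n}. i m \<noteq> i n} + card (i -` E \<inter> {..<n})"
          by (rule card_Un_le)
        finally have "real n \<le> real (card {m\<in>{..<n}. i m \<noteq> i n}) + real (card (i -` E \<inter> {..<n}))"
          by (simp only: card_lessThan of_nat_add[symmetric] of_nat_le_iff)
        then have "1 \<le> (real (card {m\<in>{..<n}. i m \<noteq> i n}) + real (card (i -` E \<inter> {..<n}))) / real n"
          using elim(2) by (simp add: le_divide_eq)
        then show ?case
          by (simp add: add_divide_distrib)
      qed
      show "eventually (\<lambda>n. ?d n \<le> 1) U"
      proof (rule always_eventually, rule allI)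
        fix n
        have "card (i -` E \<inter> {..<n}) \<le> n"
          using card_mono[of "{..<n}" "i -` E \<inter> {..<n}"] by simp
        then show "?d n \<le> 1" by (cases "n = 0") (simp_all add: divide_le_eq)
      qed
    qed simp
    then show ?thesis
      using tendsto_unique[OF bot d] True by simp
  next
    case False
    then have ev: "eventually (\<lambda>n. i n \<notin> E) U"
      using U(1) by (auto simp: ultrafilter_def)
    have "(?d \<longlongrightarrow> 0) U"
    proof (rule tendsto_sandwich[OF _ _ tendsto_const lim])
      show "eventually (\<lambda>n. ?d n \<le> ?r n) U"
        using ev
      proof eventually_elim
        case (elim n)
        have "card (i -` E \<inter> {..<n}) \<le> card {m\<in>{..<n}. i m \<noteq> i n}"
          using elim by (intro card_mono) auto
        then show ?case by (simp add: divide_right_mono)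
      qed
    qed simp
    then show ?thesis
      using tendsto_unique[OF bot d] False by simp
  qed
qed

section \<open>Transfer from coin sequences to sets of naturals\<close>

lemma topspace_powerset_topology [simp]: "topspace powerset_topology = UNIV"
  by (simp add: powerset_topology_def topspace_pullback_topology)

text \<open>In terms of characteristic functions the map is composition with \<open>i\<close>, which
  is continuous because each coordinate of the result is a coordinate of \<open>x\<close>.\<close>

lemma measurable_powerset_coins:
  "(\<lambda>x. {n. x (i n)}) \<in> measurable coins (borel_of powerset_topology)"
  unfolding borel_of_def
proof (rule measurable_measure_of)
  fix Y :: "'a set set" assume "Y \<in> {S. openin powerset_topology S}"
  moreover have "discrete_topology (UNIV :: bool set) = euclidean"
    by (simp add: discrete_topology_unique open_discrete)
  ultimately obtain W :: "('a \<Rightarrow> bool) set" where W: "open W" "Y = (\<lambda>A x. x \<in> A) -` W"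
    by (auto simp: powerset_topology_def openin_pullback_topology euclidean_product_topology)
  have "continuous_on UNIV (\<lambda>(x :: nat \<Rightarrow> bool) n. x (i n))"
    by (intro continuous_on_coordinatewise_then_product continuous_on_product_coordinates)
  then have "open ((\<lambda>x n. x (i n)) -` W)"
    using W(1) by (simp add: open_vimage)
  moreover have "(\<lambda>x. {n. x (i n)}) -` Y = (\<lambda>x n. x (i n)) -` W"
    by (auto simp: W)
  ultimately show "(\<lambda>x. {n. x (i n)}) -` Y \<inter> space coins \<in> sets coins"
    by (simp add: sets_coins)
qed auto

theorem theorem0p1:
  fixes U :: "nat filter"
  assumes "ultrafilter U" and "nonprincipal U"
  shows "\<not> universally_measurable powerset_topology (top_of_set {0..1}) (density_limit U)"
proof
  assume um: "universally_measurable powerset_topology (top_of_set {0..1}) (density_limit U)"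
  obtain i :: "nat \<Rightarrow> nat" where i: "\<And>K. finite K \<Longrightarrow> finite (i -` K)"
    "((\<lambda>n. real (card {m\<in>{..<n}. i m \<noteq> i n}) / real n) \<longlongrightarrow> 0) U"
    using ex_dominant_blocks[OF assms] by blast
  \<comment> \<open>The image of \<open>U\<close> under \<open>i\<close>, with sets written as
    characteristic functions.\<close>
  define V where "V = {x. eventually (\<lambda>n. x (i n)) U}"
  let ?\<Phi> = "\<lambda>x. {n. x (i n)}"
  let ?B = "borel_of powerset_topology :: nat set measure"
  have \<Phi>: "?\<Phi> \<in> measurable coins ?B"
    by (rule measurable_powerset_coins)
  \<comment> \<open>Any threshold strictly between the two block densities \<open>0\<close> and
    \<open>1\<close> would separate them.\<close>
  let ?H = "{A. density_limit U A > 1/2}"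
  have "openin (top_of_set {0..1}) ({0..1} \<inter> {1/2<..} :: real set)"
    by (intro openin_open_Int) simp
  then have "universally_measurable_set powerset_topology
      {A \<in> topspace powerset_topology. density_limit U A \<in> {0..1} \<inter> {1/2<..}}"
    using um unfolding universally_measurable_def by blast
  moreover have "{A \<in> topspace powerset_topology. density_limit U A \<in> {0..1} \<inter> {1/2<..}} = ?H"
    using density_limit(2)[OF assms(1)] by auto
  \<comment> \<open>Universal measurability is tested on a single measure, the image of
    \<open>coins\<close> under \<open>?\<Phi>\<close>.\<close>
  ultimately have "?H \<in> sets (completion (distr coins ?B ?\<Phi>))"
    using coins.finite_measure_distr[OF \<Phi>] by (simp add: universally_measurable_set_def)
  then obtain S N N' where H: "?H = S \<union> N" "N \<subseteq> N'" "N' \<in> null_sets (distr coins ?B ?\<Phi>)"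
    "S \<in> sets (distr coins ?B ?\<Phi>)"
    by (rule sets_completionE)
  \<comment> \<open>Completion measurability pulls back along \<open>?\<Phi>\<close>: null sets of
    the image measure have null preimages.\<close>
  have "?\<Phi> -` ?H \<in> sets (completion coins)"
  proof (rule sets_completionI)
    show "?\<Phi> -` ?H = ?\<Phi> -` S \<union> ?\<Phi> -` N" using H(1) by auto
    show "?\<Phi> -` N \<subseteq> ?\<Phi> -` N'" using H(2) by auto
    show "?\<Phi> -` N' \<in> null_sets coins"
      using H(3) null_sets_distr_iff[OF \<Phi>] by simp
    show "?\<Phi> -` S \<in> sets coins"
      using measurable_sets[OF \<Phi>, of S] H(4) by simp
  qed
  moreover have "?\<Phi> -` ?H = V"
  proof -
    have "density_limit U (?\<Phi> x) = of_bool (x \<in> V)" for x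
      using density_limit_blocks[OF assms i(2), of "{k. x k}"] by (simp add: V_def vimage_def)
    then show ?thesis by auto
  qed
  moreover have "V \<notin> sets (completion coins)"
  proof (rule not_coins_measurable)
    fix x y assume x: "x \<in> V" and "finite {k. x k \<noteq> y k}"
    \<comment> \<open>Since \<open>i\<close> is finite-to-one, a finite change of \<open>x\<close>
      affects only finitely many \<open>n\<close>, and \<open>U\<close> ignores those.\<close>
    then have "eventually (\<lambda>n. n \<notin> i -` {k. x k \<noteq> y k}) U"
      by (intro nonprincipal_ultrafilter_finite assms i(1))
    moreover have "eventually (\<lambda>n. x (i n)) U" using x by (simp add: V_def)
    ultimately show "y \<in> V"
      unfolding V_def mem_Collect_eq by eventually_elim simp
  next
    fix x
    have "\<not> (eventually (\<lambda>n. x (i n)) U \<and> eventually (\<lambda>n. \<not> x (i n)) U)"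
      using assms(1) eventually_conj[of "\<lambda>n. x (i n)" U "\<lambda>n. \<not> x (i n)"]
      by (auto simp: ultrafilter_def)
    then show "(\<lambda>k. \<not> x k) \<in> V \<longleftrightarrow> x \<notin> V"
      using assms(1) by (auto simp: V_def ultrafilter_def)
  qed
  ultimately show False by simp
qed

end
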